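(* For every real $p>0$ there exists a class $\mathcal R_p$ of graphs with bounded expansion such that the random graph $G(n,p/n)$ asymptotically almost surely belongs to $\mathcal R_p$; that is, $\Pr[G(n,p/n)\in\mathcal R_p]\to 1$ as $n\to\infty$.
   Context: All graphs are finite and simple, and classes of graphs are closed under isomorphism. $G(n,q)$ is the random graph on $n$ vertices in which each of the $\binom n2$ possible edges appears independently with probability $q$. $|G|$ is the number of vertices and $\|G\|$ the number of edges of $G$. For $d\in\mathbb N$, a graph $H$ is a shallow minor of $G$ at depth $d$ if there is a subgraph $X$ of $G$ whose connected components each have radius at most $d$, such that $H$ is a simple graph obtained from $G$ by contracting each component of $X$ into a single vertex and then taking a subgraph. (The radius of a connected graph is the minimum over vertices $r$ of the maximum distance from $r$ to another vertex.) For a class $\mathcal C$, let $\nabla_d(\mathcal C)=\sup \|H\|/|H|$, the supremum over all (non-empty) shallow minors $H$ at depth $d$ of graphs in $\mathcal C$. The class $\mathcal C$ has bounded expansion if there is a function $f:\mathbb N\to\mathbb R$ with $\nabla_d(\mathcal C)\leq f(d)$ for all $d\in\mathbb N$. *)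

theory Defs
  imports "HOL-Probability.Probability"
begin

datatype 'a ugraph = UGraph (verts: "'a set") (edges: "'a set set")

definition simple_graph :: "'a ugraph \<Rightarrow> bool" where
  "simple_graph G \<longleftrightarrow> finite (verts G) \<and> edges G \<subseteq> {e. e \<subseteq> verts G \<and> card e = 2}"

definition subgraph :: "'a ugraph \<Rightarrow> 'a ugraph \<Rightarrow> bool" where
  "subgraph K G \<longleftrightarrow> simple_graph K \<and> verts K \<subseteq> verts G \<and> edges K \<subseteq> edges G"

definition isomorphic :: "'a ugraph \<Rightarrow> 'b ugraph \<Rightarrow> bool" where
  "isomorphic G H \<longleftrightarrow>
     (\<exists>f. bij_betw f (verts G) (verts H) \<and> edges H = (\<lambda>e. f ` e) ` edges G)"

definition adj :: "'a ugraph \<Rightarrow> ('a \<times> 'a) set" where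
  "adj G = {(u, v). {u, v} \<in> edges G}"

definition induced :: "'a ugraph \<Rightarrow> 'a set \<Rightarrow> 'a ugraph" where
  "induced G W = UGraph W {e \<in> edges G. e \<subseteq> W}"

definition components :: "'a ugraph \<Rightarrow> 'a ugraph set" where
  "components G =
     induced G ` (verts G // {(u, v). u \<in> verts G \<and> v \<in> verts G \<and> (u, v) \<in> (adj G)\<^sup>*})"

text \<open>Distance and radius are only meaningful for (finite, nonempty) connected graphs;
  below they are only applied to connected components of finite graphs.\<close>

definition distance :: "'a ugraph \<Rightarrow> 'a \<Rightarrow> 'a \<Rightarrow> nat" where
  "distance G u v = (LEAST k. (u, v) \<in> adj G ^^ k)"

definition radius :: "'a ugraph \<Rightarrow> nat" where
  "radius G = Min ((\<lambda>r. Max ((\<lambda>v. distance G r v) ` verts G)) ` verts G)"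

text \<open>Contracting every component of the subgraph \<open>X\<close> of \<open>G\<close>: a contracted component is
  represented by its vertex set and a vertex \<open>v\<close> outside \<open>X\<close> by \<open>{v}\<close>. Loops
  and parallel edges are discarded, so that the result is simple.\<close>

definition contract :: "'a ugraph \<Rightarrow> 'a ugraph \<Rightarrow> 'a set ugraph" where
  "contract G X =
     (let W = verts ` components X \<union> (\<lambda>v. {v}) ` (verts G - verts X)
      in UGraph W {{A, B} | A B. A \<in> W \<and> B \<in> W \<and> A \<noteq> B \<and> (\<exists>a\<in>A. \<exists>b\<in>B. {a, b} \<in> edges G)})"

definition shallow_minor :: "nat \<Rightarrow> 'b ugraph \<Rightarrow> 'a ugraph \<Rightarrow> bool" where
  "shallow_minor d H G \<longleftrightarrow> simple_graph H \<and>
     (\<exists>X. subgraph X G \<and> (\<forall>C\<in>components X. radius C \<le> d) \<and>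
        (\<exists>K. subgraph K (contract G X) \<and> isomorphic K H))"

text \<open>Every finite graph has an isomorphic copy with vertices in \<^typ>\<open>nat\<close>, so classes of
  graphs are isomorphism-closed sets of such graphs, and their shallow minors are also taken
  there.\<close>

definition graph_class :: "nat ugraph set \<Rightarrow> bool" where
  "graph_class \<C> \<longleftrightarrow> (\<forall>G\<in>\<C>. simple_graph G) \<and>
     (\<forall>G\<in>\<C>. \<forall>H. simple_graph H \<and> isomorphic G H \<longrightarrow> H \<in> \<C>)"

definition nabla :: "nat \<Rightarrow> nat ugraph set \<Rightarrow> ereal" where
  "nabla d \<C> =
     Sup {ereal (real (card (edges H)) / real (card (verts H))) | H :: nat ugraph.
            verts H \<noteq> {} \<and> (\<exists>G\<in>\<C>. shallow_minor d H G)}"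

definition bounded_expansion :: "nat ugraph set \<Rightarrow> bool" where
  "bounded_expansion \<C> \<longleftrightarrow> (\<exists>f :: nat \<Rightarrow> real. \<forall>d. nabla d \<C> \<le> ereal (f d))"

text \<open>The random graph on the vertex set \<open>{0, \<dots>, n - 1}\<close>. Since
  \<^const>\<open>bernoulli_pmf\<close> truncates its parameter to the unit interval, an edge probability
  \<open>q > 1\<close> is read as \<open>1\<close>.\<close>

definition random_graph :: "nat \<Rightarrow> real \<Rightarrow> nat ugraph pmf" where
  "random_graph n q =
     (let P = {e. e \<subseteq> {..<n} \<and> card e = 2}
      in map_pmf (\<lambda>present. UGraph {..<n} {e \<in> P. present e})
           (Pi_pmf P False (\<lambda>_. bernoulli_pmf q)))"

end

theory Submission
  imports Defs
begin

text \<open>A dense shallow minor forces a dense subgraph, and sparse random graphs have no dense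
  subgraphs on few vertices.

  More precisely, suppose that \<open>H\<close> is a shallow minor of \<open>G\<close> at depth \<open>d\<close> with
  \<open>t\<close> vertices and at least \<open>2 * t\<close> edges. Keeping only the centers of the branch
  sets, the endpoints of \<open>2 * t\<close> representing edges and short walks between them yields a set of
  at most \<open>(4 * d + 1) * t\<close> vertices of \<open>G\<close> that spans at least \<open>t\<close> more edges than
  it has vertices (\<open>dense_minor_dense_subgraph\<close>), that is, at least
  \<open>1 + 1 / (4 * d + 1)\<close> edges per vertex.

  In the random graph with edge probability \<open>p / n\<close>, a first moment computation shows that
  for each fixed \<open>k\<close> some constant \<open>c\<close> has the following property: asymptotically almost surely,
  no nonempty set of at most \<open>n / c\<close> vertices spans \<open>1 + 1 / k\<close> or more edges
  per vertex (\<open>random_graph_sparse_on_small\<close>). So minors with few vertices, compared to \<open>n\<close>, have fewer than 2 edges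
  per vertex. Minors with linearly many vertices are harmless as well, because the random graph has
  only \<open>O(n)\<close> edges (\<open>random_graph_few_edges\<close>). Together these facts bound the
  density of the minors at any single depth (\<open>shallow_minor_density\<close>).

  Bounded expansion concerns all depths simultaneously. The class therefore demands the
  sparsity conditions for depth \<open>d\<close> only of graphs with at least \<open>N d\<close> vertices, where the
  thresholds grow fast enough that all conditions together still hold asymptotically almost
  surely (\<open>diagonal_almost_surely\<close>). The graphs with fewer than \<open>N d\<close> vertices do no harm at
  depth \<open>d\<close>, since they have fewer than \<open>N d * N d\<close> edges.\<close>

section \<open>Growing a vertex set along walks\<close>

definition spanned :: "'a set set \<Rightarrow> 'a set \<Rightarrow> 'a set set" where
  "spanned E S = {e \<in> E. e \<subseteq> S}"

lemma finite_spanned [simp]: "finite E \<Longrightarrow> finite (spanned E S)"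
  by (simp add: spanned_def)

text \<open>Walking from a vertex of \<open>S\<close>, every newly met vertex comes with the edge along which it
  was reached. Hence the number of spanned edges minus the number of vertices never drops, and
  a walk of length \<open>l\<close> costs at most \<open>l\<close> new vertices. This replaces the construction of
  spanning trees inside the branch sets of a minor.\<close>

lemma walk_extension:
  assumes "finite E" "finite S" "r \<in> S" "(r, a) \<in> {(u, v). {u, v} \<in> E} ^^ l"
  shows "\<exists>T. S \<subseteq> T \<and> a \<in> T \<and> T \<subseteq> S \<union> \<Union>E \<and> finite T \<and> card T \<le> card S + l \<and>
           card (spanned E S) + card T \<le> card (spanned E T) + card S"
  using assms(4)
proof (induction l arbitrary: a)
  case 0
  then show ?case using assms by (intro exI[of _ S]) auto
next
  case (Suc l)
  then obtain b where b: "(r, b) \<in> {(u, v). {u, v} \<in> E} ^^ l" and ba: "{b, a} \<in> E"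
    by auto
  from Suc.IH[OF b] obtain T where T: "S \<subseteq> T" "b \<in> T" "T \<subseteq> S \<union> \<Union>E" "finite T"
    "card T \<le> card S + l" "card (spanned E S) + card T \<le> card (spanned E T) + card S"
    by blast
  show ?case
  proof (cases "a \<in> T")
    case True
    with T show ?thesis by (intro exI[of _ T]) auto
  next
    case False
    have "insert {b, a} (spanned E T) \<subseteq> spanned E (insert a T)"
      using T ba by (auto simp: spanned_def)
    then have "card (insert {b, a} (spanned E T)) \<le> card (spanned E (insert a T))"
      using assms(1) by (intro card_mono) auto
    moreover have "{b, a} \<notin> spanned E T"
      using False by (auto simp: spanned_def)
    ultimately have "Suc (card (spanned E T)) \<le> card (spanned E (insert a T))"
      using assms(1) by simp
    with T False ba show ?thesis
      by (intro exI[of _ "insert a T"]) auto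
  qed
qed

lemma walks_extension:
  assumes "finite E" "finite S" "finite Q"
    and "\<And>q. q \<in> Q \<Longrightarrow> \<exists>r\<in>S. \<exists>l\<le>d. (r, q) \<in> {(u, v). {u, v} \<in> E} ^^ l"
  shows "\<exists>T. S \<subseteq> T \<and> Q \<subseteq> T \<and> T \<subseteq> S \<union> \<Union>E \<and> finite T \<and> card T \<le> card S + d * card Q \<and>
           card T \<le> card (spanned E T) + card S"
  using assms(3,4)
proof (induction Q rule: finite_induct)
  case empty
  then show ?case using assms by (intro exI[of _ S]) auto
next
  case (insert q Q)
  then obtain T where T: "S \<subseteq> T" "Q \<subseteq> T" "T \<subseteq> S \<union> \<Union>E" "finite T"
    "card T \<le> card S + d * card Q" "card T \<le> card (spanned E T) + card S"
    by blast
  obtain r l where r: "r \<in> S" "l \<le> d" "(r, q) \<in> {(u, v). {u, v} \<in> E} ^^ l"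
    using insert.prems by blast
  obtain T' where T': "T \<subseteq> T'" "q \<in> T'" "T' \<subseteq> T \<union> \<Union>E" "finite T'"
    "card T' \<le> card T + l" "card (spanned E T) + card T' \<le> card (spanned E T') + card T"
    using walk_extension[OF assms(1) T(4) _ r(3)] r T by blast
  have "card S + d * card (insert q Q) = card S + d * card Q + d"
    using insert by simp
  with T T' r show ?case
    by (intro exI[of _ T']) auto
qed

section \<open>Branch sets of shallow minors\<close>

lemma relpow_mono:
  fixes R S :: "('a \<times> 'a) set"
  assumes "R \<subseteq> S"
  shows "R ^^ l \<subseteq> S ^^ l"
  using assms by (induction l) (auto intro!: relcomp_mono)

text \<open>The radius is defined by least and extremal elements, which carry information only because a
  component is finite and any two of its vertices are joined by a walk that stays inside it.
  All that is used later is that a center reaches every vertex by a walk of length at most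
  \<open>d\<close>.\<close>

lemma component_center:
  assumes X: "simple_graph X" and C: "C \<in> components X" and rad: "radius C \<le> d"
  shows "verts C \<subseteq> verts X"
    and "\<exists>r\<in>verts C. \<forall>v\<in>verts C. \<exists>l\<le>d. (r, v) \<in> {(u, v). {u, v} \<in> edges X \<and> {u, v} \<subseteq> verts C} ^^ l"
proof -
  let ?R = "{(u, v). u \<in> verts X \<and> v \<in> verts X \<and> (u, v) \<in> (adj X)\<^sup>*}"
  obtain x where x: "x \<in> verts X" and Cx: "C = induced X (?R `` {x})"
    using C by (auto simp: components_def quotient_def)
  define K where "K = ?R `` {x}"
  have vC: "verts C = K" using Cx by (simp add: induced_def K_def)
  have adjC: "adj C = {(u, v). {u, v} \<in> edges X \<and> {u, v} \<subseteq> K}"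
    using Cx by (auto simp: induced_def K_def adj_def)
  have KX: "K \<subseteq> verts X" by (auto simp: K_def)
  then show "verts C \<subseteq> verts X" by (simp add: vC)
  have "finite K" using KX X by (auto simp: simple_graph_def intro: finite_subset)
  have "K \<noteq> {}" using x by (auto simp: K_def)
  have "sym (adj X)" by (auto simp: sym_def adj_def insert_commute)
  then have symX: "sym ((adj X)\<^sup>*)" by (rule sym_rtrancl)
  have conn: "(r, v) \<in> (adj C)\<^sup>*" if "r \<in> K" "v \<in> K" for r v
  proof -
    have "(r, x) \<in> (adj X)\<^sup>*" "(x, v) \<in> (adj X)\<^sup>*"
      using that symX by (auto simp: K_def sym_def)
    then have "(r, v) \<in> (adj X)\<^sup>*" by (rule rtrancl_trans)
    then have "(r, v) \<in> (adj C)\<^sup>* \<and> v \<in> K"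
    proof induction
      case base
      then show ?case using that by simp
    next
      case (step y z)
      have "z \<in> verts X" using step(2) X by (auto simp: adj_def simple_graph_def)
      moreover have "(x, z) \<in> (adj X)\<^sup>*"
        using step by (auto simp: K_def)
      ultimately have "z \<in> K" using x by (auto simp: K_def)
      moreover have "{y, z} \<in> edges X" using step(2) by (simp add: adj_def)
      ultimately have "(y, z) \<in> adj C" using step by (simp add: adjC)
      with step(3) \<open>z \<in> K\<close> show ?case by auto
    qed
    then show ?thesis by simp
  qed
  have "radius C \<in> (\<lambda>r. Max ((\<lambda>v. distance C r v) ` K)) ` K"
    unfolding radius_def vC using \<open>finite K\<close> \<open>K \<noteq> {}\<close> by (intro Min_in) auto
  then obtain r where r: "r \<in> K" "radius C = Max ((\<lambda>v. distance C r v) ` K)" by auto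
  have "\<exists>l\<le>d. (r, v) \<in> adj C ^^ l" if "v \<in> K" for v
  proof (intro exI conjI)
    have "distance C r v \<le> radius C" using r that \<open>finite K\<close> by simp
    then show "distance C r v \<le> d" using rad by simp
    show "(r, v) \<in> adj C ^^ distance C r v"
      unfolding distance_def using conn[OF r(1) that]
      by (metis LeastI_ex rtrancl_imp_relpow)
  qed
  with r(1) show "\<exists>r\<in>verts C. \<forall>v\<in>verts C. \<exists>l\<le>d. (r, v) \<in> {(u, v). {u, v} \<in> edges X \<and> {u, v} \<subseteq> verts C} ^^ l"
    by (auto simp: vC adjC)
qed

lemma components_disjoint:
  assumes "C \<in> components X" "D \<in> components X" "verts C \<noteq> verts D"
  shows "verts C \<inter> verts D = {}"
proof -
  let ?R = "{(u, v). u \<in> verts X \<and> v \<in> verts X \<and> (u, v) \<in> (adj X)\<^sup>*}"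
  have "sym (adj X)" by (auto simp: sym_def adj_def insert_commute)
  then have "sym ((adj X)\<^sup>*)" by (rule sym_rtrancl)
  then have "equiv (verts X) ?R"
    by (auto simp: equiv_def refl_on_def sym_def trans_def intro: rtrancl_trans)
  moreover have "verts C \<in> verts X // ?R" "verts D \<in> verts X // ?R"
    using assms by (auto simp: components_def induced_def)
  ultimately show ?thesis using assms(3) quotient_disj by blast
qed

text \<open>The vertices of a shallow minor, forgetting the contracted subgraph. Only walks inside a set
  are recorded, so the condition passes to subfamilies and treats a contracted component
  and an uncontracted vertex alike.\<close>

definition shallow_family :: "nat \<Rightarrow> 'a ugraph \<Rightarrow> 'a set set \<Rightarrow> bool" where
  "shallow_family d G \<A> \<longleftrightarrow> disjoint \<A> \<and>
     (\<forall>A\<in>\<A>. A \<subseteq> verts G \<and>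
        (\<exists>r\<in>A. \<forall>a\<in>A. \<exists>l\<le>d. (r, a) \<in> {(u, v). {u, v} \<in> edges G \<and> {u, v} \<subseteq> A} ^^ l))"

text \<open>The edge set of the graph that arises by contracting the sets of \<open>\<A>\<close>.\<close>

definition joined_pairs :: "'a set set \<Rightarrow> 'a set set \<Rightarrow> 'a set set set" where
  "joined_pairs E \<A> =
     {{A, B} | A B. A \<in> \<A> \<and> B \<in> \<A> \<and> A \<noteq> B \<and> (\<exists>a\<in>A. \<exists>b\<in>B. {a, b} \<in> E)}"

lemma shallow_family_contract:
  assumes X: "subgraph X G" and rad: "\<forall>C\<in>components X. radius C \<le> d"
  shows "shallow_family d G (verts (contract G X))"
proof -
  let ?W = "verts (contract G X)"
  have W: "?W = verts ` components X \<union> (\<lambda>v. {v}) ` (verts G - verts X)"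
    by (simp add: contract_def Let_def)
  have sX: "simple_graph X" "verts X \<subseteq> verts G" "edges X \<subseteq> edges G"
    using X by (auto simp: subgraph_def)
  have "disjoint ?W"
  proof (rule disjointI)
    fix A B assume AB: "A \<in> ?W" "B \<in> ?W" "A \<noteq> B"
    then show "A \<inter> B = {}"
      using components_disjoint component_center(1)[OF sX(1)] rad unfolding W by blast
  qed
  moreover have "A \<subseteq> verts G \<and>
        (\<exists>r\<in>A. \<forall>a\<in>A. \<exists>l\<le>d. (r, a) \<in> {(u, v). {u, v} \<in> edges G \<and> {u, v} \<subseteq> A} ^^ l)"
    if "A \<in> ?W" for A
  proof -
    from that consider C where "C \<in> components X" "A = verts C" | v where "v \<in> verts G" "A = {v}"
      unfolding W by blast
    then show ?thesis
    proof cases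
      case 1
      obtain r where r: "r \<in> A" "\<forall>v\<in>A. \<exists>l\<le>d. (r, v) \<in> {(u, v). {u, v} \<in> edges X \<and> {u, v} \<subseteq> A} ^^ l"
        using component_center(2)[OF sX(1) 1(1), of d] rad 1(1) unfolding 1(2) by blast
      have "{(u, v). {u, v} \<in> edges X \<and> {u, v} \<subseteq> A} \<subseteq> {(u, v). {u, v} \<in> edges G \<and> {u, v} \<subseteq> A}"
        using sX by auto
      then have "{(u, v). {u, v} \<in> edges X \<and> {u, v} \<subseteq> A} ^^ l \<subseteq> {(u, v). {u, v} \<in> edges G \<and> {u, v} \<subseteq> A} ^^ l" for l
        by (rule relpow_mono)
      then have "\<forall>v\<in>A. \<exists>l\<le>d. (r, v) \<in> {(u, v). {u, v} \<in> edges G \<and> {u, v} \<subseteq> A} ^^ l"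
        using r(2) by blast
      with r(1) show ?thesis
        using component_center(1)[OF sX(1) 1(1)] rad 1 sX by blast
    next
      case 2
      then show ?thesis by (auto intro!: exI[of _ 0])
    qed
  qed
  ultimately show ?thesis by (simp add: shallow_family_def)
qed

lemma isomorphic_card:
  assumes "isomorphic K H" "simple_graph K"
  shows "card (verts K) = card (verts H)" "card (edges K) = card (edges H)"
proof -
  obtain f where f: "bij_betw f (verts K) (verts H)" "edges H = (\<lambda>e. f ` e) ` edges K"
    using assms by (auto simp: isomorphic_def)
  show "card (verts K) = card (verts H)" using f(1) by (rule bij_betw_same_card)
  have "inj_on (\<lambda>e. f ` e) (edges K)"
    by (rule inj_on_subset[OF inj_on_image_Pow[OF bij_betw_imp_inj_on[OF f(1)]]])
       (use assms(2) in \<open>auto simp: simple_graph_def\<close>)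
  then show "card (edges K) = card (edges H)" by (simp add: f(2) card_image)
qed

lemma finite_edges: "simple_graph G \<Longrightarrow> finite (edges G)"
  unfolding simple_graph_def by (rule finite_subset[of _ "Pow (verts G)"]) auto

lemma shallow_minorE:
  assumes "shallow_minor d H G"
  obtains \<A> F where
    "shallow_family d G \<A>" "card \<A> = card (verts H)" "card F = card (edges H)"
    "finite \<A>" "finite F"
    "F \<subseteq> joined_pairs (edges G) \<A>"
proof -
  obtain X K where X: "subgraph X G" "\<forall>C\<in>components X. radius C \<le> d"
    and K: "subgraph K (contract G X)" "isomorphic K H"
    using assms by (auto simp: shallow_minor_def)
  have sK: "simple_graph K" "verts K \<subseteq> verts (contract G X)" "edges K \<subseteq> edges (contract G X)"
    using K by (auto simp: subgraph_def)
  have "shallow_family d G (verts K)"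
    using shallow_family_contract[OF X] sK(2)
    by (auto simp: shallow_family_def intro: pairwise_subset)
  moreover have "edges K \<subseteq> joined_pairs (edges G) (verts K)"
  proof
    fix e assume e: "e \<in> edges K"
    have "edges (contract G X) = joined_pairs (edges G) (verts (contract G X))"
      by (simp add: contract_def Let_def joined_pairs_def)
    then have "e \<in> joined_pairs (edges G) (verts (contract G X))"
      using e sK(3) by blast
    then obtain A B where AB: "e = {A, B}" "A \<noteq> B" "\<exists>a\<in>A. \<exists>b\<in>B. {a, b} \<in> edges G"
      by (auto simp: joined_pairs_def)
    have "e \<subseteq> verts K" using e sK(1) by (auto simp: simple_graph_def)
    then have "A \<in> verts K" "B \<in> verts K" using AB(1) by auto
    with AB show "e \<in> joined_pairs (edges G) (verts K)"
      unfolding joined_pairs_def mem_Collect_eq by (intro exI conjI)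
  qed
  moreover have "finite (verts K)" "finite (edges K)"
    using sK(1) finite_edges by (auto simp: simple_graph_def)
  ultimately show ?thesis
    using that[of "verts K" "edges K"] isomorphic_card[OF K(2) sK(1)] by blast
qed

text \<open>As the branch sets are disjoint, an edge with its ends in two of them meets no others. So the
  pair that it joins can be read off from it, which makes every choice of representing edges
  injective.\<close>

lemma crossing_edges:
  assumes "disjoint \<A>"
    and F: "F \<subseteq> joined_pairs E \<A>"
  shows "\<exists>\<phi>. inj_on \<phi> F \<and> (\<forall>e\<in>F. \<phi> e \<in> E \<and> finite (\<phi> e) \<and> card (\<phi> e) \<le> 2 \<and> \<phi> e \<subseteq> \<Union>\<A> \<and> (\<forall>A\<in>\<A>. \<not> \<phi> e \<subseteq> A))"
proof -
  have "\<exists>g. g \<in> E \<and> finite g \<and> card g \<le> 2 \<and> g \<subseteq> \<Union>\<A> \<and> (\<forall>A\<in>\<A>. \<not> g \<subseteq> A) \<and> {A\<in>\<A>. A \<inter> g \<noteq> {}} = e"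
    if e: "e \<in> F" for e
  proof -
    have "e \<in> joined_pairs E \<A>" using e F by blast
    then obtain A B a b where AB: "A \<in> \<A>" "B \<in> \<A>" "e = {A, B}" "A \<noteq> B" "a \<in> A" "b \<in> B" "{a, b} \<in> E"
      by (auto simp: joined_pairs_def)
    have a: "C = A" if "C \<in> \<A>" "a \<in> C" for C
      using disjointD[OF assms(1) that(1) AB(1)] that(2) AB(5) by blast
    have b: "C = B" if "C \<in> \<A>" "b \<in> C" for C
      using disjointD[OF assms(1) that(1) AB(2)] that(2) AB(6) by blast
    have "{C \<in> \<A>. C \<inter> {a, b} \<noteq> {}} = {A, B}"
    proof (intro equalityI subsetI)
      fix C assume "C \<in> {C \<in> \<A>. C \<inter> {a, b} \<noteq> {}}"
      then have "C \<in> \<A>" "a \<in> C \<or> b \<in> C" by auto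
      then show "C \<in> {A, B}" using a b by blast
    qed (use AB(1,2,5,6) in auto)
    moreover have "\<not> {a, b} \<subseteq> C" if "C \<in> \<A>" for C
    proof
      assume "{a, b} \<subseteq> C"
      then have "C = A" "C = B" using a[OF that] b[OF that] by simp_all
      with AB(4) show False by simp
    qed
    moreover have "{a, b} \<subseteq> \<Union>\<A>" using AB(1,2,5,6) by auto
    moreover have "card {a, b} \<le> 2" by (simp add: card_insert_if)
    ultimately show ?thesis using AB(3,7)
      by (intro exI[of _ "{a, b}"] conjI) simp_all
  qed
  then have "\<forall>e\<in>F. \<exists>g. g \<in> E \<and> finite g \<and> card g \<le> 2 \<and> g \<subseteq> \<Union>\<A> \<and>
      (\<forall>A\<in>\<A>. \<not> g \<subseteq> A) \<and> {A\<in>\<A>. A \<inter> g \<noteq> {}} = e"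
    by simp
  from bchoice[OF this] obtain \<phi> where \<phi>: "\<forall>e\<in>F. \<phi> e \<in> E \<and> finite (\<phi> e) \<and> card (\<phi> e) \<le> 2 \<and>
      \<phi> e \<subseteq> \<Union>\<A> \<and> (\<forall>A\<in>\<A>. \<not> \<phi> e \<subseteq> A) \<and> {A\<in>\<A>. A \<inter> \<phi> e \<noteq> {}} = e"
    ..
  have "inj_on \<phi> F"
    by (rule inj_on_inverseI[where g = "\<lambda>g. {A \<in> \<A>. A \<inter> g \<noteq> {}}"]) (use \<phi> in simp)
  with \<phi> show ?thesis by (intro exI[of _ \<phi>]) simp
qed

lemma minor_edges_le:
  assumes "simple_graph G" "shallow_minor d H G"
  shows "card (edges H) \<le> card (edges G)"
proof -
  from assms(2) obtain \<A> F where A: "shallow_family d G \<A>" "card F = card (edges H)"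
    "F \<subseteq> joined_pairs (edges G) \<A>"
    by (rule shallow_minorE)
  then obtain \<phi> where "inj_on \<phi> F" "\<phi> ` F \<subseteq> edges G"
    using crossing_edges[of \<A> F "edges G"] unfolding shallow_family_def by blast
  then show ?thesis
    using card_inj_on_le[of \<phi> F "edges G"] finite_edges[OF assms(1)] A(2) by simp
qed

section \<open>Dense shallow minors contain dense subgraphs\<close>

text \<open>Let \<open>t\<close> be the number of branch sets. Keep \<open>2 * t\<close> edges of the minor. Their
  representatives in \<open>G\<close> have at most \<open>4 * t\<close> endpoints, each at distance at
  most \<open>d\<close> from the center of its branch set. The \<open>t\<close> centers together with the
  connecting walks form a set \<open>W\<close> of at most \<open>t + 4 * t * d\<close> vertices that spans at
  least \<open>card W - t\<close> edges lying inside branch sets, and the \<open>2 * t\<close> edges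
  between branch sets come on top. The point is that the size of \<open>W\<close> is bounded however
  large the branch sets are, so that the surplus \<open>t\<close> is a fixed fraction of it.\<close>

lemma dense_minor_dense_subgraph:
  assumes G: "simple_graph G" and minor: "shallow_minor d H G"
    and dense: "2 * card (verts H) \<le> card (edges H)"
  shows "\<exists>W \<subseteq> verts G. card W \<le> (4 * d + 1) * card (verts H) \<and> card (verts H) \<le> card W \<and>
           card W + card (verts H) \<le> card (spanned (edges G) W)"
proof -
  from minor obtain \<A> F0 where fam: "shallow_family d G \<A>" and cA: "card \<A> = card (verts H)"
    and cF0: "card F0 = card (edges H)" and finA: "finite \<A>"
    and F0: "F0 \<subseteq> joined_pairs (edges G) \<A>"
    by (rule shallow_minorE) blast
  define t where "t = card (verts H)"
  obtain F where F: "F \<subseteq> F0" "card F = 2 * t" "finite F"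
    using obtain_subset_with_card_n[of "2 * t" F0] dense cF0 t_def by auto
  have disj: "disjoint \<A>" using fam by (simp add: shallow_family_def)
  obtain \<phi> where inj: "inj_on \<phi> F"
    and \<phi>: "\<And>e. e \<in> F \<Longrightarrow> \<phi> e \<in> edges G \<and> finite (\<phi> e) \<and> card (\<phi> e) \<le> 2 \<and> \<phi> e \<subseteq> \<Union>\<A> \<and> (\<forall>A\<in>\<A>. \<not> \<phi> e \<subseteq> A)"
    using crossing_edges[OF disj subset_trans[OF F(1) F0]] by blast
  have "\<forall>A\<in>\<A>. \<exists>r. r \<in> A \<and>
      (\<forall>a\<in>A. \<exists>l\<le>d. (r, a) \<in> {(u, v). {u, v} \<in> edges G \<and> {u, v} \<subseteq> A} ^^ l)"
    using fam unfolding shallow_family_def Bex_def by blast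
  from bchoice[OF this] obtain root where root: "\<And>A. A \<in> \<A> \<Longrightarrow> root A \<in> A \<and>
      (\<forall>a\<in>A. \<exists>l\<le>d. (root A, a) \<in> {(u, v). {u, v} \<in> edges G \<and> {u, v} \<subseteq> A} ^^ l)"
    by blast
  \<comment> \<open>The walks may only use edges inside branch sets, so that the representing edges
    stay available for the surplus.\<close>
  define E where "E = {e \<in> edges G. \<exists>A\<in>\<A>. e \<subseteq> A}"
  define S where "S = root ` \<A>"
  define Q where "Q = (\<Union>e\<in>F. \<phi> e)"
  have finE: "finite E" using finite_edges[OF G] by (simp add: E_def)
  have "inj_on root \<A>"
  proof (rule inj_onI)
    fix A B assume AB: "A \<in> \<A>" "B \<in> \<A>" "root A = root B"
    then have "root A \<in> A \<inter> B" using root[OF AB(1)] root[OF AB(2)] by simp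
    then show "A = B" using disjointD[OF disj AB(1,2)] by blast
  qed
  then have cS: "card S = t" "finite S" using cA finA by (auto simp: S_def card_image t_def)
  have finQ: "finite Q" using F \<phi> by (auto simp: Q_def)
  have "card Q \<le> (\<Sum>e\<in>F. card (\<phi> e))" unfolding Q_def using F by (intro card_UN_le) auto
  also have "\<dots> \<le> (\<Sum>e\<in>F. 2)" using \<phi> by (intro sum_mono) auto
  finally have cQ: "card Q \<le> 4 * t" using F by simp
  have reach: "\<exists>r\<in>S. \<exists>l\<le>d. (r, q) \<in> {(u, v). {u, v} \<in> E} ^^ l" if q: "q \<in> Q" for q
  proof -
    obtain e where "e \<in> F" "q \<in> \<phi> e" using q by (auto simp: Q_def)
    then obtain A where A: "A \<in> \<A>" "q \<in> A" using \<phi>[of e] by blast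
    obtain l where l: "l \<le> d" "(root A, q) \<in> {(u, v). {u, v} \<in> edges G \<and> {u, v} \<subseteq> A} ^^ l"
      using root[OF A(1)] A(2) by blast
    have "{(u, v). {u, v} \<in> edges G \<and> {u, v} \<subseteq> A} \<subseteq> {(u, v). {u, v} \<in> E}"
      using A by (auto simp: E_def)
    then have "(root A, q) \<in> {(u, v). {u, v} \<in> E} ^^ l"
      using l(2) relpow_mono by blast
    with l A show ?thesis by (auto simp: S_def)
  qed
  obtain W where W: "S \<subseteq> W" "Q \<subseteq> W" "W \<subseteq> S \<union> \<Union>E" "finite W"
    "card W \<le> card S + d * card Q" "card W \<le> card (spanned E W) + card S"
    using walks_extension[OF finE cS(2) finQ reach] by blast
  have AG: "\<Union>\<A> \<subseteq> verts G" using fam by (auto simp: shallow_family_def)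
  have "S \<subseteq> \<Union>\<A>" using root by (auto simp: S_def)
  moreover have "\<Union>E \<subseteq> \<Union>\<A>" by (auto simp: E_def)
  ultimately have "W \<subseteq> verts G"
    using W(3) AG by blast
  moreover have "d * card Q \<le> d * (4 * t)" using cQ by (rule mult_le_mono2)
  then have "card W \<le> t + d * (4 * t)" using W(5) cS(1) by linarith
  then have "card W \<le> (4 * d + 1) * t" by (simp add: algebra_simps)
  moreover have "t \<le> card W" using card_mono[OF W(4,1)] cS by simp
  moreover have "card (spanned E W \<union> \<phi> ` F) \<le> card (spanned (edges G) W)"
  proof (rule card_mono)
    show "finite (spanned (edges G) W)" using finite_edges[OF G] by simp
    have "\<phi> e \<subseteq> W" if "e \<in> F" for e using that W(2) by (auto simp: Q_def)
    then show "spanned E W \<union> \<phi> ` F \<subseteq> spanned (edges G) W"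
      using \<phi> unfolding spanned_def E_def by blast
  qed
  moreover have "card (spanned E W \<union> \<phi> ` F) = card (spanned E W) + card (\<phi> ` F)"
  proof (rule card_Un_disjoint)
    show "finite (spanned E W)" "finite (\<phi> ` F)" using F(3) finE by simp_all
    show "spanned E W \<inter> \<phi> ` F = {}" using \<phi> unfolding spanned_def E_def by blast
  qed
  ultimately show ?thesis
    using W(6) cS card_image[OF inj] F(2) unfolding t_def[symmetric]
    by (intro exI[of _ W]) auto
qed

text \<open>The admitted surplus over one edge per vertex and the admitted relative size of the sets enter
  through their reciprocals \<open>k\<close> and \<open>c\<close>, which keeps the condition within the
  natural numbers.\<close>

definition sparse_on_small :: "nat \<Rightarrow> nat \<Rightarrow> 'a ugraph \<Rightarrow> bool" where
  "sparse_on_small k c G \<longleftrightarrow>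
     (\<forall>W \<subseteq> verts G. W \<noteq> {} \<longrightarrow> c * card W \<le> card (verts G) \<longrightarrow>
        k * card (spanned (edges G) W) < (k + 1) * card W)"

text \<open>A minor with at most \<open>card (verts G) / (c * (4 * d + 1))\<close> vertices and at
  least twice as many edges would yield a small set of vertices that spans too many edges. A
  larger minor has bounded density for the trivial reason that it has at most as many edges as
  \<open>G\<close>, hence at most \<open>C * card (verts G)\<close>.\<close>

lemma shallow_minor_density:
  assumes G: "simple_graph G" and edges: "card (edges G) \<le> C * card (verts G)"
    and sparse: "sparse_on_small (4 * d + 1) c G"
    and minor: "shallow_minor d H G"
  shows "card (edges H) \<le> (2 + C * c * (4 * d + 1)) * card (verts H)"
proof (rule ccontr)
  define t where "t = card (verts H)"
  assume "\<not> ?thesis"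
  then have big: "(2 + C * c * (4 * d + 1)) * t < card (edges H)" by (simp add: t_def)
  then have "2 * card (verts H) \<le> card (edges H)" unfolding t_def
    by (simp add: algebra_simps)
  then obtain W where W: "W \<subseteq> verts G" "card W \<le> (4 * d + 1) * t" "t \<le> card W"
     "card W + t \<le> card (spanned (edges G) W)"
    using dense_minor_dense_subgraph[OF G minor] by (auto simp: t_def)
  have H: "simple_graph H" using minor by (simp add: shallow_minor_def)
  have "t \<noteq> 0"
  proof
    assume "t = 0"
    then have "verts H = {}" using H by (auto simp: t_def simple_graph_def)
    then have "edges H = {}" using H by (auto simp: simple_graph_def)
    with big show False by simp
  qed
  then have "W \<noteq> {}" using W(3) by auto
  have "(4 * d + 1 + 1) * card W \<le> (4 * d + 1) * (card W + t)"
    using W(2) by (simp add: algebra_simps)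
  also have "\<dots> \<le> (4 * d + 1) * card (spanned (edges G) W)"
    using W(4) by (rule mult_le_mono2)
  finally have "\<not> c * card W \<le> card (verts G)"
    using sparse W(1) \<open>W \<noteq> {}\<close> unfolding sparse_on_small_def by (meson not_le)
  then have "card (verts G) \<le> c * ((4 * d + 1) * t)"
    using mult_le_mono2[OF W(2), of c] by linarith
  then have "C * card (verts G) \<le> C * (c * ((4 * d + 1) * t))"
    by (rule mult_le_mono2)
  then have "card (edges H) \<le> C * c * (4 * d + 1) * t"
    using edges minor_edges_le[OF G minor] unfolding mult.assoc by linarith
  with big show False by (simp add: algebra_simps)
qed

section \<open>Invariance under isomorphism\<close>

lemma isomorphic_spanned:
  assumes "bij_betw f (verts G) (verts H)" "edges H = (\<lambda>e. f ` e) ` edges G" "simple_graph G"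
    and W: "W \<subseteq> verts G"
  shows "card (spanned (edges H) (f ` W)) = card (spanned (edges G) W)"
proof -
  have inj: "inj_on f (verts G)" using assms(1) by (rule bij_betw_imp_inj_on)
  have eG: "e \<subseteq> verts G" if "e \<in> edges G" for e
    using assms(3) that by (auto simp: simple_graph_def)
  have "spanned (edges H) (f ` W) = (\<lambda>e. f ` e) ` spanned (edges G) W"
    unfolding spanned_def assms(2) using inj_on_image_subset_iff[OF inj] eG W by auto
  moreover have "inj_on (\<lambda>e. f ` e) (spanned (edges G) W)"
    by (rule inj_on_subset[OF inj_on_image_Pow[OF inj]]) (use eG in \<open>auto simp: spanned_def\<close>)
  ultimately show ?thesis by (simp add: card_image)
qed

lemma isomorphic_sparse_on_small:
  assumes "isomorphic G H" "simple_graph G" "sparse_on_small k c G"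
  shows "sparse_on_small k c H"
proof -
  obtain f where f: "bij_betw f (verts G) (verts H)" "edges H = (\<lambda>e. f ` e) ` edges G"
    using assms by (auto simp: isomorphic_def)
  show ?thesis unfolding sparse_on_small_def
  proof (intro allI impI)
    fix W assume W: "W \<subseteq> verts H" "W \<noteq> {}" "c * card W \<le> card (verts H)"
    then obtain U where U: "U \<subseteq> verts G" "W = f ` U"
      using f(1) by (metis bij_betw_imp_surj_on subset_image_iff)
    have "card W = card U"
      using U f(1) by (metis bij_betw_imp_inj_on card_image inj_on_subset)
    moreover have "card (verts H) = card (verts G)" using f(1) by (simp add: bij_betw_same_card)
    ultimately show "k * card (spanned (edges H) W) < (k + 1) * card W"
      using assms(3) W U isomorphic_spanned[OF f assms(2) U(1)] by (auto simp: sparse_on_small_def)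
  qed
qed

section \<open>First moment bounds for the random graph\<close>

lemma choose_two_le: "n choose 2 \<le> n * n"
  using binomial_fact_pow[of n 2] by (simp add: power2_eq_square)

text \<open>The left-hand side over the factorial is one term of the exponential series at \<open>m\<close>, and
  \<open>exp 1 \<le> 3\<close>.\<close>

lemma power_self_le_fact: "real m ^ m \<le> 3 ^ m * fact m"
proof -
  have s: "(\<lambda>n. real m ^ n / fact n) sums exp (real m)"
    using exp_converges[of "real m"] by (simp add: field_simps)
  have "real m ^ m / fact m = (\<Sum>n\<in>{m}. real m ^ n / fact n)" by simp
  also have "\<dots> \<le> exp (real m)"
    unfolding sums_unique[OF s] by (rule sum_le_suminf[OF sums_summable[OF s]]) auto
  also have "exp (real m) = exp 1 ^ m"
    using exp_of_nat_mult[of m "1::real"] by simp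
  also have "\<dots> \<le> 3 ^ m" by (intro power_mono exp_le) simp
  finally show ?thesis by (simp add: field_simps)
qed

lemma choose_le_power:
  assumes "m > 0"
  shows "real (N choose m) \<le> (3 * real N / real m) ^ m"
proof -
  have "real (N choose m) * real m ^ m \<le> real (N choose m) * (3 ^ m * fact m)"
    by (intro mult_left_mono power_self_le_fact) simp
  also have "\<dots> = 3 ^ m * real ((N choose m) * fact m)" by simp
  also have "\<dots> \<le> 3 ^ m * real (N ^ m)"
    by (intro mult_left_mono of_nat_mono binomial_fact_pow) simp
  also have "\<dots> = (3 * real N) ^ m" by (simp add: power_mult_distrib)
  finally show ?thesis using assms by (simp add: power_divide field_simps)
qed

text \<open>An inequality rather than an equation, because it then also covers \<open>q > 1\<close>, where
  edges are present with probability 1.\<close>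

lemma prob_all_present:
  assumes "finite P" "S \<subseteq> P" "0 \<le> q"
  shows "measure_pmf.prob (Pi_pmf P False (\<lambda>_. bernoulli_pmf q)) {f. \<forall>e\<in>S. f e} \<le> q ^ card S"
proof -
  have "{f. \<forall>e\<in>S. f e} = Pi P (\<lambda>e. if e \<in> S then {True} else UNIV)"
    using assms(2) by (auto simp: Pi_def split: if_splits)
  then have "measure_pmf.prob (Pi_pmf P False (\<lambda>_. bernoulli_pmf q)) {f. \<forall>e\<in>S. f e} =
      (\<Prod>e\<in>P. measure_pmf.prob (bernoulli_pmf q) (if e \<in> S then {True} else UNIV))"
    using assms(1) by (simp add: measure_Pi_pmf_Pi)
  also have "\<dots> = (\<Prod>e\<in>P. if e \<in> S then pmf (bernoulli_pmf q) True else 1)"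
    by (intro prod.cong) (auto simp: measure_pmf_single)
  also have "\<dots> = (\<Prod>e\<in>P \<inter> S. pmf (bernoulli_pmf q) True)"
    by (simp only: prod.inter_restrict[OF assms(1)])
  also have "\<dots> = pmf (bernoulli_pmf q) True ^ card S"
    using assms(2) by (simp add: Int_absorb1)
  also have "pmf (bernoulli_pmf q) True \<le> q"
  proof (cases "q \<le> 1")
    case False
    then show ?thesis using pmf_le_1[of "bernoulli_pmf q" True] by linarith
  qed (use assms(3) in simp)
  then have "pmf (bernoulli_pmf q) True ^ card S \<le> q ^ card S" by (intro power_mono) auto
  finally show ?thesis .
qed

text \<open>Union bound over the possible sets of \<open>m\<close> edges inside \<open>W\<close>.\<close>

lemma prob_spanned_ge:
  assumes W: "W \<subseteq> {..<n}" and q: "0 \<le> q"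
  shows "measure_pmf.prob (random_graph n q) {G. m \<le> card (spanned (edges G) W)}
           \<le> real ((card W choose 2) choose m) * q ^ m"
proof -
  define P where "P = {e. e \<subseteq> {..<n} \<and> card e = 2}"
  define PW where "PW = {e. e \<subseteq> W \<and> card e = 2}"
  let ?M = "Pi_pmf P False (\<lambda>_. bernoulli_pmf q)"
  have finW: "finite W" using W by (rule finite_subset) simp
  have finP: "finite P" by (rule finite_subset[of _ "Pow {..<n}"]) (auto simp: P_def)
  have PWP: "PW \<subseteq> P" using W by (auto simp: P_def PW_def)
  then have finPW: "finite PW" using finP by (rule finite_subset)
  have "measure_pmf.prob (random_graph n q) {G. m \<le> card (spanned (edges G) W)} =
      measure_pmf.prob ?M {f. m \<le> card {e \<in> PW. f e}}"
  proof -
    have "random_graph n q = map_pmf (\<lambda>f. UGraph {..<n} {e \<in> P. f e}) ?M"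
      by (simp add: random_graph_def P_def Let_def)
    moreover have "spanned {e \<in> P. f e} W = {e \<in> PW. f e}" for f
      using W by (auto simp: spanned_def P_def PW_def)
    ultimately show ?thesis by (simp add: vimage_def)
  qed
  also have "\<dots> \<le> measure_pmf.prob ?M (\<Union>S\<in>{S. S \<subseteq> PW \<and> card S = m}. {f. \<forall>e\<in>S. f e})"
  proof (rule measure_pmf.finite_measure_mono)
    show "{f. m \<le> card {e \<in> PW. f e}} \<subseteq> (\<Union>S\<in>{S. S \<subseteq> PW \<and> card S = m}. {f. \<forall>e\<in>S. f e})"
    proof
      fix f assume "f \<in> {f. m \<le> card {e \<in> PW. f e}}"
      then obtain S where "S \<subseteq> {e \<in> PW. f e}" "card S = m"
        using obtain_subset_with_card_n[of m "{e \<in> PW. f e}"] by auto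
      then show "f \<in> (\<Union>S\<in>{S. S \<subseteq> PW \<and> card S = m}. {f. \<forall>e\<in>S. f e})" by blast
    qed
  qed simp
  also have "\<dots> \<le> (\<Sum>S\<in>{S. S \<subseteq> PW \<and> card S = m}. measure_pmf.prob ?M {f. \<forall>e\<in>S. f e})"
    using finPW by (intro measure_UNION_le) auto
  also have "\<dots> \<le> (\<Sum>S\<in>{S. S \<subseteq> PW \<and> card S = m}. q ^ m)"
    using prob_all_present[OF finP _ q] PWP by (intro sum_mono) auto
  also have "\<dots> = real (card PW choose m) * q ^ m"
    using finPW by (simp add: n_subsets)
  also have "card PW = card W choose 2"
    using finW by (simp add: PW_def n_subsets)
  finally show ?thesis .
qed

lemma random_graph_support:
  assumes "G \<in> set_pmf (random_graph n q)"
  shows "verts G = {..<n}" "simple_graph G"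
  using assms by (auto simp: random_graph_def Let_def simple_graph_def)

lemma prob_mono_on_support:
  assumes "\<And>x. x \<in> set_pmf M \<Longrightarrow> x \<in> A \<Longrightarrow> x \<in> B"
  shows "measure_pmf.prob M A \<le> measure_pmf.prob M B"
proof -
  have "measure_pmf.prob M A = measure_pmf.prob M (A \<inter> set_pmf M)"
    by (simp add: measure_Int_set_pmf)
  also have "\<dots> \<le> measure_pmf.prob M B"
    using assms by (intro measure_pmf.finite_measure_mono) auto
  finally show ?thesis .
qed

text \<open>The union bound over all sets of \<open>C * n\<close> possible edges gives
  \<open>(3 * p / C) ^ (C * n)\<close>, and \<open>C\<close> is chosen to make the base at most \<open>1 / 2\<close>.\<close>

lemma random_graph_few_edges:
  assumes p: "p > 0" and C: "6 * p \<le> real C"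
  shows "(\<lambda>n. measure_pmf.prob (random_graph n (p / real n)) {G. \<not> card (edges G) \<le> C * card (verts G)})
           \<longlonglongrightarrow> 0"
proof (rule tendsto_sandwich[of "\<lambda>_. 0" _ _ "\<lambda>n. (1 / 2) ^ n"])
  have C0: "C > 0" using p C by (cases "C = 0") auto
  show "\<forall>\<^sub>F n in sequentially. measure_pmf.prob (random_graph n (p / real n))
      {G. \<not> card (edges G) \<le> C * card (verts G)} \<le> (1 / 2) ^ n"
    using eventually_gt_at_top[of 0]
  proof eventually_elim
    case (elim n)
    let ?m = "C * n"
    have "measure_pmf.prob (random_graph n (p / real n)) {G. \<not> card (edges G) \<le> C * card (verts G)}
        \<le> measure_pmf.prob (random_graph n (p / real n)) {G. ?m \<le> card (spanned (edges G) {..<n})}"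
    proof (rule prob_mono_on_support)
      fix G assume G: "G \<in> set_pmf (random_graph n (p / real n))"
        "G \<in> {G. \<not> card (edges G) \<le> C * card (verts G)}"
      note r = random_graph_support[OF G(1)]
      have "spanned (edges G) {..<n} = edges G"
        using r by (auto simp: spanned_def simple_graph_def)
      then show "G \<in> {G. ?m \<le> card (spanned (edges G) {..<n})}" using G(2) r(1) by simp
    qed
    also have "\<dots> \<le> real ((n choose 2) choose ?m) * (p / real n) ^ ?m"
      using prob_spanned_ge[of "{..<n}" n "p / real n" ?m] p by simp
    also have "\<dots> \<le> (3 * real (n choose 2) / real ?m) ^ ?m * (p / real n) ^ ?m"
      using elim C0 p by (intro mult_right_mono choose_le_power) auto
    also have "\<dots> = (3 * real (n choose 2) / real ?m * (p / real n)) ^ ?m"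
      by (simp only: power_mult_distrib)
    also have "\<dots> \<le> (1 / 2) ^ ?m"
    proof (rule power_mono)
      have "real (n choose 2) \<le> real n * real n"
        using choose_two_le[of n] by (metis of_nat_mono of_nat_mult)
      then have "3 * real (n choose 2) / real ?m * (p / real n) \<le> 3 * (real n * real n) / real ?m * (p / real n)"
        using p by (intro mult_right_mono divide_right_mono mult_left_mono) auto
      also have "\<dots> = 3 * p / real C" using elim by simp
      also have "\<dots> \<le> 1 / 2" using C C0 by (simp add: field_simps)
      finally show "3 * real (n choose 2) / real ?m * (p / real n) \<le> 1 / 2" .
    qed (use p in simp)
    also have "\<dots> \<le> (1 / 2) ^ n" using C0 by (intro power_decreasing) auto
    finally show ?case .
  qed
qed (auto intro!: LIMSEQ_power_zero)

text \<open>The left-hand side is the union bound for the event that some set of \<open>v\<close> vertices spans at least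
  \<open>v + s\<close> edges, where the surplus \<open>s\<close> is \<open>v / k\<close> rounded up. With the estimate \<open>(3 * N / m) ^ m\<close> for binomial
  coefficients, the choice of the vertices contributes \<open>(3 * n / v) ^ v\<close> and the edges
  contribute \<open>(3 * p * v / n) ^ (v + s)\<close>. The powers with exponent \<open>v\<close> cancel up
  to a factor \<open>(9 * p) ^ v\<close>, which is absorbed by the surplus since \<open>v \<le> k * s\<close>; what
  remains is at most \<open>(B * v / n) ^ s\<close>. As \<open>B * v / n \<le> 1 / 2\<close> for small sets, one factor is kept to
  gain \<open>1 / n\<close> and the others give geometric decay in \<open>v\<close>, at the rate
  \<open>root k (1 / 2)\<close>.\<close>

lemma sparse_term_bound:
  fixes p :: real
  assumes p: "p > 0" and k: "k > 0" and v: "v > 0" and n: "c * v \<le> n"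
    and B: "B = (9 * p + 1) ^ k * (3 * p)" and c: "2 * B \<le> real c"
    and s: "s = (v + k - 1) div k"
  shows "real (n choose v) * (real ((v choose 2) choose (v + s)) * (p / real n) ^ (v + s))
           \<le> 2 * B / real n * (real v * root k (1 / 2) ^ v)"
proof -
  have B0: "B > 0" using p B by simp
  then have "c > 0" using c by (cases "c = 0") auto
  then have n0: "n > 0" using n v by (metis gr0I mult_is_0 le_zero_eq not_less_zero)
  have vks: "v \<le> k * s" 
  proof -
    have "v + k - 1 = k * s + (v + k - 1) mod k" by (simp add: s)
    moreover have "(v + k - 1) mod k < k" using k by simp
    ultimately show ?thesis by linarith
  qed
  then have s0: "s > 0" using v by (cases s) auto
  let ?x = "3 * p * real v / real n"
  have x0: "?x > 0" using p v n0 by simp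
  have sq: "real (v choose 2) \<le> real v * real (v + s)"
  proof -
    have "v choose 2 \<le> v * v" by (rule choose_two_le)
    also have "\<dots> \<le> v * (v + s)" by simp
    finally show ?thesis by (metis of_nat_mono of_nat_mult)
  qed
  have "real ((v choose 2) choose (v + s)) * (p / real n) ^ (v + s)
      \<le> (3 * real (v choose 2) / real (v + s)) ^ (v + s) * (p / real n) ^ (v + s)"
    using v p by (intro mult_right_mono choose_le_power) auto
  also have "\<dots> = (3 * real (v choose 2) / real (v + s) * (p / real n)) ^ (v + s)"
    by (simp only: power_mult_distrib)
  also have "\<dots> \<le> ?x ^ (v + s)"
  proof (rule power_mono)
    have "3 * real (v choose 2) / real (v + s) * (p / real n)
        \<le> 3 * (real v * real (v + s)) / real (v + s) * (p / real n)"
      using p sq by (intro mult_right_mono divide_right_mono mult_left_mono) auto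
    also have "\<dots> = ?x" using v by (simp add: field_simps del: of_nat_add)
    finally show "3 * real (v choose 2) / real (v + s) * (p / real n) \<le> ?x" .
  qed (use p in simp)
  finally have 1: "real ((v choose 2) choose (v + s)) * (p / real n) ^ (v + s) \<le> ?x ^ (v + s)" .
  have "real (n choose v) * (real ((v choose 2) choose (v + s)) * (p / real n) ^ (v + s))
      \<le> (3 * real n / real v) ^ v * ?x ^ (v + s)"
    using choose_le_power[OF v, of n] 1 p by (intro mult_mono) auto
  also have "\<dots> = (3 * real n / real v * ?x) ^ v * ?x ^ s"
    unfolding power_add power_mult_distrib by (simp only: mult.assoc)
  also have "3 * real n / real v * ?x = 9 * p" using n0 v by simp
  also have "(9 * p) ^ v * ?x ^ s \<le> (9 * p + 1) ^ (k * s) * ?x ^ s"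
  proof (rule mult_right_mono)
    have "(9 * p) ^ v \<le> (9 * p + 1) ^ v" using p by (intro power_mono) auto
    also have "\<dots> \<le> (9 * p + 1) ^ (k * s)" using p vks by (intro power_increasing) auto
    finally show "(9 * p) ^ v \<le> (9 * p + 1) ^ (k * s)" .
  qed (use x0 in simp)
  also have "\<dots> = ((9 * p + 1) ^ k * ?x) ^ s"
    by (simp only: power_mult power_mult_distrib)
  also have "(9 * p + 1) ^ k * ?x = B * real v / real n" by (simp add: B)
  also have "(B * real v / real n) ^ s = B * real v / real n * (B * real v / real n) ^ (s - 1)"
    using s0 by (metis Suc_diff_1 power_Suc)
  also have "\<dots> \<le> B * real v / real n * (1 / 2) ^ (s - 1)"
  proof (intro mult_left_mono power_mono)
    have "2 * B * real v \<le> real c * real v" using c by (intro mult_right_mono) auto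
    also have "\<dots> \<le> real n" using n by (metis of_nat_mono of_nat_mult)
    finally show "B * real v / real n \<le> 1 / 2" using n0 by (simp add: field_simps)
  qed (use B0 in auto)
  also have "\<dots> = 2 * B / real n * (real v * (1 / 2) ^ s)"
    using s0 by (cases s) auto
  also have "\<dots> \<le> 2 * B / real n * (real v * root k (1 / 2) ^ v)"
  proof (intro mult_left_mono)
    have "(1 / 2 :: real) ^ s = root k (1 / 2) ^ (k * s)"
      using k by (simp add: power_mult real_root_pow_pos2)
    also have "\<dots> \<le> root k (1 / 2) ^ v"
      using vks k by (intro power_decreasing) auto
    finally show "(1 / 2 :: real) ^ s \<le> root k (1 / 2) ^ v" .
  qed (use B0 in auto)
  finally show ?thesis .
qed

text \<open>The bounds for the single sizes \<open>v\<close> are \<open>1 / n\<close> times the terms of one convergent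
  series, so that the probability of failure is \<open>O(1 / n)\<close>.\<close>

lemma random_graph_sparse_on_small:
  fixes p :: real
  assumes p: "p > 0" and k: "k > 0"
  shows "\<exists>c. (\<lambda>n. measure_pmf.prob (random_graph n (p / real n)) {G. \<not> sparse_on_small k c G}) \<longlonglongrightarrow> 0"
proof -
  define B where "B = (9 * p + 1) ^ k * (3 * p)"
  define c where "c = nat \<lceil>2 * B\<rceil>"
  have c: "2 * B \<le> real c" unfolding c_def by (rule real_nat_ceiling_ge)
  have B0: "B > 0" using p by (simp add: B_def)
  then have c0: "c > 0" using c by (cases "c = 0") auto
  define r where "r = root k (1 / 2)"
  have r: "0 \<le> r" "r < 1" using k by (simp_all add: r_def)
  have sm: "summable (\<lambda>v. real (Suc v) * r ^ v)"
    using geometric_deriv_sums[of r] r by (auto intro: sums_summable)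
  define K where "K = 2 * B * (\<Sum>v. real (Suc v) * r ^ v)"
  have bound: "measure_pmf.prob (random_graph n (p / real n)) {G. \<not> sparse_on_small k c G} \<le> K / real n"
    for n
  proof -
    let ?M = "random_graph n (p / real n)"
    define V where "V = {v. v > 0 \<and> c * v \<le> n}"
    define s where "s v = (v + k - 1) div k" for v
    define D where "D v W = {G :: nat ugraph. v + s v \<le> card (spanned (edges G) W)}" for v W
    define U where "U v = {W. W \<subseteq> {..<n} \<and> card W = v}" for v
    have finU: "finite (U v)" for v
      by (rule finite_subset[of _ "Pow {..<n}"]) (auto simp: U_def)
    have finV: "finite V"
    proof (rule finite_subset)
      show "V \<subseteq> {..n}" using c0 by (auto simp: V_def intro: order_trans[rotated])
    qed simp
    have "measure_pmf.prob ?M {G. \<not> sparse_on_small k c G} \<le> measure_pmf.prob ?M (\<Union>v\<in>V. \<Union>W\<in>U v. D v W)"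
    proof (rule prob_mono_on_support)
      fix G assume G: "G \<in> set_pmf ?M" "G \<in> {G. \<not> sparse_on_small k c G}"
      then obtain W where W: "W \<subseteq> {..<n}" "W \<noteq> {}" "c * card W \<le> n"
        "(k + 1) * card W \<le> k * card (spanned (edges G) W)"
        using random_graph_support(1)[OF G(1)] by (auto simp: sparse_on_small_def not_less)
      let ?v = "card W"
      have "finite W" using W(1) by (rule finite_subset) simp
      then have "?v \<in> V" using W by (auto simp: V_def card_gt_0_iff)
      moreover have "W \<in> U ?v" using W by (simp add: U_def)
      moreover have "?v + s ?v \<le> card (spanned (edges G) W)"
      proof -
        let ?e = "card (spanned (edges G) W)"
        have "k * ?v \<le> k * ?e" using W(4) unfolding add_mult_distrib by linarith
        then have "?v \<le> ?e" using k by simp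
        have "s ?v < Suc (?e - ?v)"
          unfolding s_def
        proof (rule less_mult_imp_div_less)
          have "?v \<le> k * (?e - ?v)" using W(4) by (simp add: diff_mult_distrib2)
          then show "?v + k - 1 < Suc (?e - ?v) * k" using k by (simp add: mult.commute)
        qed
        with \<open>?v \<le> ?e\<close> show ?thesis by simp
      qed
      ultimately show "G \<in> (\<Union>v\<in>V. \<Union>W\<in>U v. D v W)" by (auto simp: D_def)
    qed
    also have "\<dots> \<le> (\<Sum>v\<in>V. measure_pmf.prob ?M (\<Union>W\<in>U v. D v W))"
      using finV by (intro measure_UNION_le) auto
    also have "\<dots> \<le> (\<Sum>v\<in>V. \<Sum>W\<in>U v. measure_pmf.prob ?M (D v W))"
      using finU by (intro sum_mono measure_UNION_le) auto
    also have "\<dots> \<le> (\<Sum>v\<in>V. \<Sum>W\<in>U v. real ((v choose 2) choose (v + s v)) * (p / real n) ^ (v + s v))"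
    proof (intro sum_mono)
      fix v W assume "W \<in> U v"
      then have W: "W \<subseteq> {..<n}" "card W = v" by (auto simp: U_def)
      show "measure_pmf.prob ?M (D v W) \<le> real ((v choose 2) choose (v + s v)) * (p / real n) ^ (v + s v)"
        using prob_spanned_ge[OF W(1), of "p / real n" "v + s v"] p W(2) by (simp add: D_def)
    qed
    also have "\<dots> = (\<Sum>v\<in>V. real (n choose v) * (real ((v choose 2) choose (v + s v)) * (p / real n) ^ (v + s v)))"
      by (simp add: U_def n_subsets)
    also have "\<dots> \<le> (\<Sum>v\<in>V. 2 * B / real n * (real v * r ^ v))"
      using sparse_term_bound[OF p k _ _ B_def c s_def]
      by (intro sum_mono) (simp add: V_def r_def)
    also have "\<dots> = 2 * B / real n * (\<Sum>v\<in>V. real v * r ^ v)"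
      by (simp add: sum_distrib_left)
    also have "\<dots> \<le> 2 * B / real n * (\<Sum>v\<in>V. real (Suc v) * r ^ v)"
      using r B0 by (intro mult_left_mono sum_mono mult_right_mono) auto
    also have "\<dots> \<le> 2 * B / real n * (\<Sum>v. real (Suc v) * r ^ v)"
      using r B0 finV sm by (intro mult_left_mono sum_le_suminf) auto
    finally show ?thesis by (simp add: K_def)
  qed
  have "(\<lambda>n. measure_pmf.prob (random_graph n (p / real n)) {G. \<not> sparse_on_small k c G}) \<longlonglongrightarrow> 0"
    by (rule tendsto_sandwich[of "\<lambda>_. 0" _ _ "\<lambda>n. K / real n"])
      (use bound lim_const_over_n[of K] in auto)
  then show ?thesis ..
qed

section \<open>Infinitely many asymptotic properties at once\<close>

text \<open>Countably many properties, each of which holds asymptotically almost surely, cannot in general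
  be demanded simultaneously for a given \<open>n\<close>. If however the property \<open>Q d\<close> is only
  demanded from a threshold \<open>N d\<close> on, at which its probability of failure has dropped below
  \<open>(1 / 2) ^ d\<close>, then the failure probabilities are dominated by a convergent series, and their sum
  tends to 0 by dominated convergence for series.\<close>

lemma diagonal_almost_surely:
  fixes M :: "nat \<Rightarrow> 'a pmf"
  assumes lim: "\<And>d. (\<lambda>n. measure_pmf.prob (M n) {x. \<not> Q d x}) \<longlonglongrightarrow> 0"
  shows "\<exists>N :: nat \<Rightarrow> nat. (\<lambda>n. measure_pmf.prob (M n) {x. \<forall>d. N d \<le> n \<longrightarrow> Q d x}) \<longlonglongrightarrow> 1"
proof -
  have "\<exists>N. \<forall>n\<ge>N. measure_pmf.prob (M n) {x. \<not> Q d x} < (1 / 2) ^ d" for d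
    using order_tendstoD(2)[OF lim[of d], of "(1 / 2) ^ d"] by (simp add: eventually_sequentially)
  then obtain N where N: "\<And>d n. N d \<le> n \<Longrightarrow> measure_pmf.prob (M n) {x. \<not> Q d x} < (1 / 2) ^ d"
    by metis
  define bad where "bad d n = (if N d \<le> n then {x. \<not> Q d x} else {})" for d n
  define a where "a d n = measure_pmf.prob (M n) (bad d n)" for d n
  have le: "norm (a d n) \<le> (1 / 2) ^ d" for d n
    using N[of d n] by (auto simp: a_def bad_def)
  have sm: "summable (\<lambda>d. a d n)" for n
    by (rule summable_comparison_test'[OF summable_geometric[of "1 / 2 :: real"] le]) simp
  have "(\<lambda>n. a d n) \<longlonglongrightarrow> 0" for d
  proof (rule tendsto_sandwich[OF _ _ tendsto_const lim[of d]])
    show "\<forall>\<^sub>F n in sequentially. a d n \<le> measure_pmf.prob (M n) {x. \<not> Q d x}"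
      by (simp add: a_def bad_def)
  qed (simp add: a_def)
  then have "(\<lambda>n. \<Sum>d. a d n) \<longlonglongrightarrow> (\<Sum>d. 0)"
    using tannerys_theorem[of a "\<lambda>_. 0" sequentially "\<lambda>d. (1 / 2) ^ d"] le
    by (simp add: case_prod_unfold summable_geometric)
  then have sum0: "(\<lambda>n. \<Sum>d. a d n) \<longlonglongrightarrow> 0" by simp
  have prob: "measure_pmf.prob (M n) {x. \<forall>d. N d \<le> n \<longrightarrow> Q d x} = 1 - measure_pmf.prob (M n) (\<Union>d. bad d n)" for n
  proof -
    have "{x. \<forall>d. N d \<le> n \<longrightarrow> Q d x} = UNIV - (\<Union>d. bad d n)" by (auto simp: bad_def)
    then show ?thesis using measure_pmf.prob_compl[of "\<Union>d. bad d n" "M n"] by simp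
  qed
  have "(\<lambda>n. measure_pmf.prob (M n) (\<Union>d. bad d n)) \<longlonglongrightarrow> 0"
  proof (rule tendsto_sandwich[OF _ _ tendsto_const sum0])
    show "\<forall>\<^sub>F n in sequentially. measure_pmf.prob (M n) (\<Union>d. bad d n) \<le> (\<Sum>d. a d n)"
      using measure_pmf.finite_measure_subadditive_countably[of "\<lambda>d. bad d _"] sm
      by (simp add: a_def)
  qed simp
  then have "(\<lambda>n. 1 - measure_pmf.prob (M n) (\<Union>d. bad d n)) \<longlonglongrightarrow> 1 - 0"
    by (intro tendsto_diff tendsto_const)
  then show ?thesis by (intro exI[of _ N]) (simp add: prob)
qed

section \<open>A class of bounded expansion that contains almost all sparse random graphs\<close>

theorem theorem4p4:
  fixes p :: real
  assumes "p > 0"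
  shows "\<exists>\<R> :: nat ugraph set. graph_class \<R> \<and> bounded_expansion \<R> \<and>
           (\<lambda>n. measure_pmf.prob (random_graph n (p / real n)) \<R>) \<longlonglongrightarrow> 1"
proof -
  let ?M = "\<lambda>n. random_graph n (p / real n)"
  obtain C :: nat where C: "6 * p \<le> real C" using real_arch_simple by blast
  have "\<exists>c. (\<lambda>n. measure_pmf.prob (?M n) {G. \<not> sparse_on_small (4 * d + 1) c G}) \<longlonglongrightarrow> 0" for d
    using random_graph_sparse_on_small[OF assms, of "4 * d + 1"] by simp
  then obtain c where
    c: "\<And>d. (\<lambda>n. measure_pmf.prob (?M n) {G. \<not> sparse_on_small (4 * d + 1) (c d) G}) \<longlonglongrightarrow> 0"
    by metis
  define Q :: "nat \<Rightarrow> nat ugraph \<Rightarrow> bool" where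
    "Q d G \<longleftrightarrow> card (edges G) \<le> C * card (verts G) \<and> sparse_on_small (4 * d + 1) (c d) G" for d G
  have "(\<lambda>n. measure_pmf.prob (?M n) {G. \<not> Q d G}) \<longlonglongrightarrow> 0" for d
  proof (rule tendsto_sandwich[OF _ _ tendsto_const])
    show "(\<lambda>n. measure_pmf.prob (?M n) {G. \<not> card (edges G) \<le> C * card (verts G)} +
        measure_pmf.prob (?M n) {G. \<not> sparse_on_small (4 * d + 1) (c d) G}) \<longlonglongrightarrow> 0"
      using tendsto_add[OF random_graph_few_edges[OF assms C] c[of d]] by simp
    have "{G. \<not> Q d G} = {G. \<not> card (edges G) \<le> C * card (verts G)} \<union>
        {G. \<not> sparse_on_small (4 * d + 1) (c d) G}" by (auto simp: Q_def)
    then show "\<forall>\<^sub>F n in sequentially. measure_pmf.prob (?M n) {G. \<not> Q d G} \<le>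
        measure_pmf.prob (?M n) {G. \<not> card (edges G) \<le> C * card (verts G)} +
        measure_pmf.prob (?M n) {G. \<not> sparse_on_small (4 * d + 1) (c d) G}"
      by (simp only: measure_Un_le sets_measure_pmf UNIV_I eventually_True)
  qed simp
  then obtain N :: "nat \<Rightarrow> nat" where
    N: "(\<lambda>n. measure_pmf.prob (?M n) {G. \<forall>d. N d \<le> n \<longrightarrow> Q d G}) \<longlonglongrightarrow> 1"
    using diagonal_almost_surely[of ?M Q] by blast
  define R where "R = {G :: nat ugraph. simple_graph G \<and> (\<forall>d. N d \<le> card (verts G) \<longrightarrow> Q d G)}"
  have "graph_class R"
    unfolding graph_class_def
  proof (intro conjI ballI allI impI)
    fix G H :: "nat ugraph" assume G: "G \<in> R" and H: "simple_graph H \<and> isomorphic G H"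
    then have G': "simple_graph G" by (simp add: R_def)
    have cards: "card (verts G) = card (verts H)" "card (edges G) = card (edges H)"
      using isomorphic_card[of G H] H G' by simp_all
    then have "Q d H" if "Q d G" for d
      using that isomorphic_sparse_on_small[of G H] H G' by (simp add: Q_def)
    with G H cards(1) show "H \<in> R" by (simp add: R_def)
  qed (simp add: R_def)
  moreover have "bounded_expansion R"
    unfolding bounded_expansion_def
  proof (intro exI allI)
    fix d
    \<comment> \<open>The first two summands serve graphs with at least \<open>N d\<close> vertices, the last one serves
      the others.\<close>
    let ?b = "2 + C * c d * (4 * d + 1) + N d * N d"
    show "nabla d R \<le> ereal (real ?b)"
      unfolding nabla_def
    proof (rule Sup_least)
      fix x assume "x \<in> {ereal (real (card (edges H)) / real (card (verts H))) | H :: nat ugraph.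
        verts H \<noteq> {} \<and> (\<exists>G\<in>R. shallow_minor d H G)}"
      then obtain H G :: "nat ugraph" where x: "x = ereal (real (card (edges H)) / real (card (verts H)))"
        and H: "verts H \<noteq> {}" and G: "G \<in> R" and minor: "shallow_minor d H G"
        by blast
      have G': "simple_graph G" using G by (simp add: R_def)
      have "finite (verts H)" using minor by (simp add: shallow_minor_def simple_graph_def)
      then have t: "card (verts H) > 0" using H by (simp add: card_gt_0_iff)
      have "card (edges H) \<le> ?b * card (verts H)"
      proof (cases "N d \<le> card (verts G)")
        case True
        then have "Q d G" using G by (simp add: R_def)
        then have "card (edges H) \<le> (2 + C * c d * (4 * d + 1)) * card (verts H)"
          using shallow_minor_density[OF G' _ _ minor] by (simp add: Q_def)
        also have "\<dots> \<le> ?b * card (verts H)" by (intro mult_le_mono1) simp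
        finally show ?thesis .
      next
        case False
        have "card (edges H) \<le> card (edges G)" by (rule minor_edges_le[OF G' minor])
        also have "\<dots> \<le> card {e. e \<subseteq> verts G \<and> card e = 2}"
          using G' by (intro card_mono) (auto simp: simple_graph_def)
        also have "\<dots> = card (verts G) choose 2"
          using G' by (simp add: simple_graph_def n_subsets)
        also have "\<dots> \<le> card (verts G) * card (verts G)" by (rule choose_two_le)
        also have "\<dots> \<le> N d * N d" using False by (intro mult_le_mono) auto
        also have "\<dots> \<le> ?b * 1" by simp
        also have "\<dots> \<le> ?b * card (verts H)" using t by (intro mult_le_mono2) simp
        finally show ?thesis .
      qed
      then have "real (card (edges H)) \<le> real ?b * real (card (verts H))"
        by (metis of_nat_mono of_nat_mult)
      then show "x \<le> ereal (real ?b)"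
        using t unfolding x ereal_less_eq by (subst pos_divide_le_eq) simp_all
    qed
  qed
  moreover have "(\<lambda>n. measure_pmf.prob (?M n) R) \<longlonglongrightarrow> 1"
  proof (rule tendsto_sandwich[OF _ _ N tendsto_const])
    have "measure_pmf.prob (?M n) {G. \<forall>d. N d \<le> n \<longrightarrow> Q d G} \<le> measure_pmf.prob (?M n) R" for n
      by (rule prob_mono_on_support) (simp add: R_def random_graph_support)
    then show "\<forall>\<^sub>F n in sequentially.
        measure_pmf.prob (?M n) {G. \<forall>d. N d \<le> n \<longrightarrow> Q d G} \<le> measure_pmf.prob (?M n) R"
      by simp
  qed simp
  ultimately show ?thesis by blast
qed

end
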